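(* Let $q\in\mathbb{C}$ with $0<|q|<1$, let $h\in\mathbb{Z}$, $r\in\mathbb{Z}_{\ge 0}$, $x\in\mathbb{R}$, $n\in\mathbb{Z}_{\ge 0}$, and let $a,b\in\mathbb{N}$ be positive integers with $a\equiv 1\pmod 2$ and $b\equiv 1\pmod 2$. Then $$[2]_{q^b}^r\,[a]_q^n \sum_{j_1,\dots,j_r=0}^{a-1} (-1)^{j_1+\cdots+j_r}\, q^{b\sum_{l=1}^{r}(h-l+1)j_l}\, E_{n,q^a}^{(h,r)}\!\left(bx+\frac{b(j_1+\cdots+j_r)}{a}\right)$$ $$=[2]_{q^a}^r\,[b]_q^n \sum_{j_1,\dots,j_r=0}^{b-1} (-1)^{j_1+\cdots+j_r}\, q^{a\sum_{l=1}^{r}(h-l+1)j_l}\, E_{n,q^b}^{(h,r)}\!\left(ax+\frac{a(j_1+\cdots+j_r)}{b}\right).$$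
   Context: Fix a logarithm $\log q$ of $q$ and set $q^y=\exp(y\log q)$ for real $y$; for a positive integer $a$, powers of the base $q^a$ are $(q^a)^y=q^{ay}$. The $q$-number is $[y]_q=\frac{1-q^y}{1-q}$, and $[y]_{q^a}=\frac{1-q^{ay}}{1-q^a}$. The convention $0^0=1$ is used. Write $(z:q)_r=(1-z)(1-zq)\cdots(1-zq^{r-1})$. The $(h,q)$-extension of the higher-order Euler polynomials is $$E_{n,q}^{(h,r)}(x)=\frac{[2]_q^r}{(1-q)^n}\sum_{l=0}^n\binom{n}{l}\frac{(-q^x)^l}{(-q^{h-r+l+1}:q)_r},\qquad (-q^x)^l=(-1)^lq^{lx}.$$ When the following series converges (i.e. $h\ge r$ or $r=0$), this equals $$[2]_q^r\sum_{m_1,\dots,m_r=0}^\infty q^{\sum_{j=1}^r(h-j+1)m_j}(-1)^{m_1+\cdots+m_r}[m_1+\cdots+m_r+x]_q^n,$$ the coefficient of $t^n/n!$ in $[2]_q^r\sum_{m_1,\dots,m_r\ge0} q^{\sum_{j=1}^r(h-j+1)m_j}(-1)^{\sum_j m_j}e^{[m_1+\cdots+m_r+x]_qt}$. $E_{n,q^a}^{(h,r)}$ denotes the same expression with $q$ replaced by $q^a$ throughout. *)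

theory Defs
  imports Complex_Main "HOL-Library.FuncSet"
begin

text \<open>
  Non-integral real powers of a complex base depend on the chosen logarithm. All q-quantities
  are therefore parametrised by a logarithm \<open>L\<close> of the base instead of the base itself: for
  base \<open>q = exp L\<close>, passing from \<open>q\<close> to \<open>q^a\<close>, with the convention \<open>(q^a)^y = q^(a y)\<close>, is passing
  from \<open>L\<close> to \<open>of_nat a * L\<close>.
\<close>

definition qpow :: "complex \<Rightarrow> real \<Rightarrow> complex" where
  "qpow L y = exp (complex_of_real y * L)"

definition qnum :: "complex \<Rightarrow> real \<Rightarrow> complex" where
  "qnum L y = (1 - qpow L y) / (1 - exp L)"

definition qpoch :: "complex \<Rightarrow> complex \<Rightarrow> nat \<Rightarrow> complex" where
  "qpoch z q r = (\<Prod>i<r. 1 - z * q ^ i)"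

text \<open>
  The polynomial \<open>E_{n,q}^{(h,r)}(x)\<close> with \<open>q = exp L\<close>, in its closed form, which (unlike the
  multiple series) makes sense for all integers \<open>h\<close>. For \<open>0 < |q| < 1\<close> no denominator vanishes.
\<close>

definition hq_Euler :: "complex \<Rightarrow> int \<Rightarrow> nat \<Rightarrow> nat \<Rightarrow> real \<Rightarrow> complex" where
  "hq_Euler L h r n x =
     qnum L 2 ^ r / (1 - exp L) ^ n *
     (\<Sum>l = 0..n. of_nat (n choose l) *
        ((- qpow L x) ^ l / qpoch (- qpow L (of_int (h - int r + int l + 1))) (exp L) r))"

end

theory Submission imports Defs begin

text \<open>
  Both sides equal the same expression, symmetric in \<open>a\<close> and \<open>b\<close>. In the closed form of
  \<open>E_{n,q^a}^{(h,r)}(bx + b(j_1 + ... + j_r)/a)\<close> the indices \<open>j_1, ..., j_r\<close> enter the \<open>k\<close>-th summand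
  only through \<open>q^{abxk} q^{bk(j_1 + ... + j_r)}\<close>. Interchanging the sums, the sum over \<open>j\<close> therefore
  factors into \<open>r\<close> geometric sums with ratios \<open>-q^{bc}\<close>, where \<open>c = h - l + 1 + k\<close>, \<open>1 \<le> l \<le> r\<close>.
  As \<open>a\<close> is odd, each of these is \<open>(1 + q^{abc}) / (1 + q^{bc})\<close>. The \<open>q\<close>-shifted factorial in the
  denominator is the product of the \<open>1 + q^{ac}\<close> over the same \<open>c\<close>, so the \<open>k\<close>-th summand carries
  the symmetric factor \<open>\<Prod>\<^sub>c (1 + q^{abc}) / ((1 + q^{ac}) (1 + q^{bc}))\<close>. What remains are the
  prefactors: \<open>[2]_{q^a}^r\<close> from the Euler polynomial complements \<open>[2]_{q^b}^r\<close>, and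
  \<open>[a]_q^n / (1 - q^a)^n = 1 / (1 - q)^n\<close> no longer depends on \<open>a\<close>. Because \<open>|q| < 1\<close>, none of the
  denominators vanishes.
\<close>

lemma qpow_add: "qpow L (y + z) = qpow L y * qpow L z"
  by (simp add: qpow_def exp_add ring_distribs)

lemma qpow_power: "qpow L y ^ k = qpow L (real k * y)"
  by (simp add: qpow_def exp_of_nat_mult[symmetric] mult.assoc)

lemma qpow_scale: "qpow (of_nat a * L) y = qpow L (real a * y)"
  by (simp add: qpow_def mult_ac)

lemma qpow_sum: "qpow L (\<Sum>i\<in>A. f i) = (\<Prod>i\<in>A. qpow L (f i))"
  by (induction A rule: infinite_finite_induct) (simp_all add: qpow_add, simp_all add: qpow_def)

lemma exp_scale_eq_qpow: "exp (of_nat a * L) = qpow L (real a)"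
  by (simp add: qpow_def)

text \<open>
  Only \<open>y = 0\<close> gives a power of modulus one, and that power is \<open>1\<close>, not \<open>-1\<close>.
\<close>

lemma one_plus_qpow_nonzero:
  assumes "norm (exp L) < 1"
  shows "1 + qpow L y \<noteq> 0"
proof
  assume "1 + qpow L y = 0"
  then have minus_one: "qpow L y = -1"
    by (metis add_eq_0_iff)
  then have "norm (qpow L y) = 1" by simp
  then have "y * Re L = 0"
    by (simp add: qpow_def norm_exp_eq_Re)
  moreover have "Re L < 0" using assms by (simp add: norm_exp_eq_Re)
  ultimately have "y = 0" by simp
  with minus_one show False by (simp add: qpow_def)
qed

lemma one_minus_qpow_nonzero:
  assumes "norm (exp L) < 1" and "y > 0"
  shows "1 - qpow L y \<noteq> 0"
proof -
  have "norm (qpow L y) < 1"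
    using assms by (simp add: norm_exp_eq_Re qpow_def mult_pos_neg)
  then show ?thesis by auto
qed

lemma alternating_geometric_sum:
  fixes z :: complex
  assumes "odd a" and "1 + z \<noteq> 0"
  shows "(\<Sum>j = 0..<a. (- z) ^ j) = (1 + z ^ a) / (1 + z)"
proof -
  have "(1 + z) * (\<Sum>j = 0..<a. (- z) ^ j) = 1 + z ^ a"
    using one_diff_power_eq[of "- z" a] assms(1) by (simp add: lessThan_atLeast0)
  with assms(2) show ?thesis by (simp add: field_simps)
qed

text \<open>
  The reflection \<open>i = r - l\<close> turns the \<open>q\<close>-shifted factorial into a product over the same weights
  \<open>h - l + 1\<close> that occur as exponents in the multiple sum.
\<close>

lemma qpoch_eq_prod_weights:
  "qpoch (- qpow (of_nat a * L) (of_int (h - int r + int k + 1))) (exp (of_nat a * L)) r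
     = (\<Prod>l = 1..r. 1 + qpow L (real a * of_int (h - int l + 1 + int k)))"
proof -
  have "qpoch (- qpow (of_nat a * L) (of_int (h - int r + int k + 1))) (exp (of_nat a * L)) r
      = (\<Prod>i<r. 1 + qpow L (real a * of_int (h - int r + int k + 1 + int i)))"
    unfolding qpoch_def qpow_scale exp_scale_eq_qpow qpow_power mult_minus_left qpow_add[symmetric]
    by (simp add: algebra_simps)
  also have "\<dots> = (\<Prod>l = 1..r. 1 + qpow L (real a * of_int (h - int l + 1 + int k)))"
    by (rule prod.reindex_bij_witness[of _ "\<lambda>l. r - l" "\<lambda>i. r - i"])
      (auto simp: of_nat_diff algebra_simps)
  finally show ?thesis .
qed

text \<open>
  Collecting the powers of \<open>q\<close> by index, each \<open>j l\<close> occurs with the exponent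
  \<open>b (h - l + 1 + k) j l\<close>. The summand is thus a product of functions of the individual \<open>j l\<close>, and
  the sum over the box is a product of geometric sums.
\<close>

lemma multiple_alternating_sum:
  assumes "norm (exp L) < 1" and "odd a"
  shows "(\<Sum>j \<in> {1..r} \<rightarrow>\<^sub>E {0..<a}. (- 1) ^ (\<Sum>l = 1..r. j l) *
            qpow L (of_int (int b * (\<Sum>l = 1..r. (h - int l + 1) * int (j l)))) *
            qpow L (real b * real k * real (\<Sum>l = 1..r. j l)))
       = (\<Prod>l = 1..r. (1 + qpow L (real (a * b) * of_int (h - int l + 1 + int k))) /
            (1 + qpow L (real b * of_int (h - int l + 1 + int k))))"
    (is "sum ?f _ = _")
proof -
  let ?z = "\<lambda>l. qpow L (real b * of_int (h - int l + 1 + int k))"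
  have "?f j = (\<Prod>l = 1..r. (- ?z l) ^ j l)" for j
  proof -
    have "?f j = (- 1) ^ (\<Sum>l = 1..r. j l) *
        qpow L (\<Sum>l = 1..r. real (j l) * (real b * of_int (h - int l + 1 + int k)))"
      by (simp add: mult.assoc qpow_add[symmetric] sum_distrib_left sum.distrib[symmetric]
          algebra_simps)
    also have "\<dots> = (\<Prod>l = 1..r. (- ?z l) ^ j l)"
      by (simp only: qpow_sum qpow_power[symmetric] power_sum prod.distrib[symmetric]
          power_mult_distrib[symmetric]) simp
    finally show ?thesis .
  qed
  then have "sum ?f ({1..r} \<rightarrow>\<^sub>E {0..<a}) = (\<Prod>l = 1..r. \<Sum>i = 0..<a. (- ?z l) ^ i)"
    by (simp add: prod_sum_PiE)
  also have "\<dots> = (\<Prod>l = 1..r. (1 + ?z l ^ a) / (1 + ?z l))"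
    using assms by (intro prod.cong refl alternating_geometric_sum one_plus_qpow_nonzero)
  finally show ?thesis
    by (simp add: qpow_power mult.assoc)
qed

definition symmetric_Euler_sum :: "complex \<Rightarrow> int \<Rightarrow> nat \<Rightarrow> nat \<Rightarrow> nat \<Rightarrow> nat \<Rightarrow> real \<Rightarrow> complex" where
  "symmetric_Euler_sum L h r n a b x =
     (\<Sum>k = 0..n. of_nat (n choose k) * (- 1) ^ k * qpow L (real (a * b) * real k * x) *
       (\<Prod>l = 1..r. (1 + qpow L (real (a * b) * of_int (h - int l + 1 + int k))) /
          ((1 + qpow L (real a * of_int (h - int l + 1 + int k))) *
           (1 + qpow L (real b * of_int (h - int l + 1 + int k))))))"

lemma symmetric_Euler_sum_commute:
  "symmetric_Euler_sum L h r n a b x = symmetric_Euler_sum L h r n b a x"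
  by (simp add: symmetric_Euler_sum_def mult.commute)

text \<open>
  The argument of the Euler polynomial is chosen so that \<open>q^a\<close> raised to it has the exponent
  \<open>abx + b(j_1 + ... + j_r)\<close>: the factor \<open>a\<close> clears the denominator. The first part is already
  symmetric, the second is absorbed by the geometric sums, and the asymmetric prefactor \<open>[2]_{q^a}^r\<close>
  is what the other side of the identity supplies.
\<close>

lemma alternating_sum_hq_Euler:
  assumes "norm (exp L) < 1" and "a > 0" and "odd a"
  shows "qnum L (real a) ^ n *
       (\<Sum>j \<in> {1..r} \<rightarrow>\<^sub>E {0..<a}.
          (- 1) ^ (\<Sum>l = 1..r. j l) *
          qpow L (of_int (int b * (\<Sum>l = 1..r. (h - int l + 1) * int (j l)))) *
          hq_Euler (of_nat a * L) h r n
            (real b * x + real b * real (\<Sum>l = 1..r. j l) / real a))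
     = qnum (of_nat a * L) 2 ^ r / (1 - exp L) ^ n * symmetric_Euler_sum L h r n a b x"
proof -
  define S where "S j = (\<Sum>l = 1..r. j l)" for j :: "nat \<Rightarrow> nat"
  define g where "g j = (- 1) ^ S j *
      qpow L (of_int (int b * (\<Sum>l = 1..r. (h - int l + 1) * int (j l))))" for j
  define c where "c k = of_nat (n choose k) * (- 1) ^ k * qpow L (real (a * b) * real k * x)" for k
  define d where "d k = (\<Prod>l = 1..r. 1 + qpow L (real a * of_int (h - int l + 1 + int k)))" for k
  define C where "C = qnum (of_nat a * L) 2 ^ r / (1 - qpow L (real a)) ^ n"
  have Euler: "hq_Euler (of_nat a * L) h r n (real b * x + real b * real (S j) / real a)
      = C * (\<Sum>k = 0..n. c k / d k * qpow L (real b * real k * real (S j)))" for j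
  proof -
    have "(- qpow (of_nat a * L) (real b * x + real b * real (S j) / real a)) ^ k
        = (- 1) ^ k * (qpow L (real (a * b) * real k * x) * qpow L (real b * real k * real (S j)))" for k
    proof -
      have "(- qpow (of_nat a * L) (real b * x + real b * real (S j) / real a)) ^ k
          = (- 1) ^ k * qpow L (real k * (real a * (real b * x + real b * real (S j) / real a)))"
        by (subst power_minus) (simp only: qpow_scale qpow_power)
      also have "real k * (real a * (real b * x + real b * real (S j) / real a))
          = real (a * b) * real k * x + real b * real k * real (S j)"
        using assms(2) by (simp add: field_simps)
      finally show ?thesis by (simp only: qpow_add)
    qed
    then show ?thesis
      unfolding hq_Euler_def qpoch_eq_prod_weights
      by (simp add: C_def c_def d_def exp_scale_eq_qpow mult.assoc)
  qed
  have "(\<Sum>j \<in> {1..r} \<rightarrow>\<^sub>E {0..<a}. g j *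
        hq_Euler (of_nat a * L) h r n (real b * x + real b * real (S j) / real a))
      = (\<Sum>j \<in> {1..r} \<rightarrow>\<^sub>E {0..<a}. \<Sum>k = 0..n.
          C * (c k / d k * (g j * qpow L (real b * real k * real (S j)))))"
    unfolding Euler sum_distrib_left by (intro sum.cong refl) (simp only: mult_ac)
  also have "\<dots> = C * (\<Sum>k = 0..n. c k / d k *
        (\<Sum>j \<in> {1..r} \<rightarrow>\<^sub>E {0..<a}. g j * qpow L (real b * real k * real (S j))))"
    by (subst sum.swap) (simp only: sum_distrib_left)
  also have "\<dots> = C * symmetric_Euler_sum L h r n a b x"
    unfolding g_def S_def multiple_alternating_sum[OF assms(1,3)] symmetric_Euler_sum_def c_def d_def
    by (simp add: prod_dividef prod.distrib mult_ac)
  finally have "(\<Sum>j \<in> {1..r} \<rightarrow>\<^sub>E {0..<a}. g j *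
        hq_Euler (of_nat a * L) h r n (real b * x + real b * real (S j) / real a))
      = C * symmetric_Euler_sum L h r n a b x" .
  moreover have "qnum L (real a) ^ n * C = qnum (of_nat a * L) 2 ^ r / (1 - exp L) ^ n"
    using one_minus_qpow_nonzero[OF assms(1), of "real a"] assms(2)
    by (simp add: C_def qnum_def power_divide)
  ultimately show ?thesis
    by (simp only: g_def S_def mult.assoc[symmetric])
qed

theorem theorem2p2:
  fixes q lq :: complex and h :: int and r n a b :: nat and x :: real
  assumes "exp lq = q"
    and "0 < norm q" and "norm q < 1"
    and "a > 0" and "b > 0" and "odd a" and "odd b"
  shows
    "qnum (of_nat b * lq) 2 ^ r * qnum lq (real a) ^ n *
       (\<Sum>j \<in> {1..r} \<rightarrow>\<^sub>E {0..<a}.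
          (- 1) ^ (\<Sum>l = 1..r. j l) *
          qpow lq (of_int (int b * (\<Sum>l = 1..r. (h - int l + 1) * int (j l)))) *
          hq_Euler (of_nat a * lq) h r n
            (real b * x + real b * real (\<Sum>l = 1..r. j l) / real a))
     = qnum (of_nat a * lq) 2 ^ r * qnum lq (real b) ^ n *
       (\<Sum>j \<in> {1..r} \<rightarrow>\<^sub>E {0..<b}.
          (- 1) ^ (\<Sum>l = 1..r. j l) *
          qpow lq (of_int (int a * (\<Sum>l = 1..r. (h - int l + 1) * int (j l)))) *
          hq_Euler (of_nat b * lq) h r n
            (real a * x + real a * real (\<Sum>l = 1..r. j l) / real b))"
proof -
  have "norm (exp lq) < 1" using assms by simp
  note reduce = alternating_sum_hq_Euler[OF this]
  show ?thesis
    unfolding mult.assoc[of "_ ^ r"] reduce[OF \<open>a > 0\<close> \<open>odd a\<close>] reduce[OF \<open>b > 0\<close> \<open>odd b\<close>]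
      symmetric_Euler_sum_commute[of lq h r n b a x]
    by simp
qed

end
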